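(* Let $\mathcal I$ be an ideal on $\mathbb N$ such that there exist pairwise disjoint sets $D_n\in \mathcal I^+$, $n\in \mathbb N$, and a set $C\in \mathcal I^+\cap \mathcal I_{1/n}$ such that $\{e_{D_n}(i):i\in C\}\in\mathcal I^+$ for each $n\in \mathbb N$. Then (1) $AOS(\mathcal I)\neq\emptyset$, (2) $AOS(\mathcal I^* )\neq\emptyset$, (3) $AOS(\mathcal I)$ is $\mathfrak c$-lineable, (4) $AOS(\mathcal I^* )$ is $\mathfrak c$-lineable, (5) $AOS(\mathcal I)$ is spaceable, (6) $AOS(\mathcal I^* )$ is spaceable.
   Context: $\mathbb N=\{1,2,\dots\}$; $\mathfrak c$ is the cardinality of the continuum. An ideal on $\mathbb N$ is a nonempty family $\mathcal I\subseteq\mathcal P(\mathbb N)$ closed under subsets and finite unions, containing all finite subsets of $\mathbb N$, with $\mathbb N\notin\mathcal I$. $\mathcal I^*=\{\mathbb N\setminus A: A\in\mathcal I\}$ is the dual filter and $\mathcal I^+=\{A\subseteq\mathbb N:A\notin\mathcal I\}$ is the coideal. $\mathcal I_{1/n}=\{A\subseteq\mathbb N:\sum_{n\in A}\frac1n<\infty\}$ is the summable ideal. For an infinite $D\subseteq\mathbb N$, $e_D:\mathbb N\to D$ is the increasing enumeration of $D$. For a real sequence $(x_n)$: $(x_n)$ is $\mathcal I$-convergent to $0$ if $\{n:|x_n|\ge\varepsilon\}\in\mathcal I$ for every $\varepsilon>0$; it is $\mathcal I^*$-convergent to $0$ if there is $F\in\mathcal I^*$ such that the subsequence $(x_n)_{n\in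 F}$ converges to $0$ in the ordinary sense. $\ell_1$ is the Banach space of real sequences with absolutely convergent series, with norm $\lVert(a_n)\rVert=\sum_{n=1}^\infty|a_n|$. $AOS(\mathcal I)$ (resp. $AOS(\mathcal I^* )$) is the set of all $(a_n)\in\ell_1$ such that $(na_n)$ is not $\mathcal I$-convergent (resp. not $\mathcal I^*$-convergent) to zero. A subset $Y\subseteq\ell_1$ is $\kappa$-lineable if $Y\cup\{0\}$ contains a vector subspace of dimension $\kappa$, and spaceable if $Y\cup\{0\}$ contains a closed infinite-dimensional vector subspace. *)

theory Defs
  imports "HOL-Analysis.Analysis"
begin

text \<open>
  The index set of the mathematics is the set of positive integers. It is rendered as the
  subset below of type nat; ideals live on this subset, and the value of a sequence
  \<open>x :: nat \<Rightarrow> real\<close> at 0 plays no role.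
\<close>

abbreviation posnat :: "nat set" where
  "posnat \<equiv> {1..}"

definition ideal_on_posnat :: "nat set set \<Rightarrow> bool" where
  "ideal_on_posnat I \<longleftrightarrow>
     I \<subseteq> Pow posnat \<and> I \<noteq> {} \<and>
     (\<forall>A\<in>I. \<forall>B. B \<subseteq> A \<longrightarrow> B \<in> I) \<and>
     (\<forall>A\<in>I. \<forall>B\<in>I. A \<union> B \<in> I) \<and>
     (\<forall>A. A \<subseteq> posnat \<and> finite A \<longrightarrow> A \<in> I) \<and>
     posnat \<notin> I"

definition dual_filter :: "nat set set \<Rightarrow> nat set set" where
  "dual_filter I = {posnat - A | A. A \<in> I}"

definition coideal :: "nat set set \<Rightarrow> nat set set" where
  "coideal I = {A. A \<subseteq> posnat \<and> A \<notin> I}"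

definition summable_ideal :: "nat set set" where
  "summable_ideal = {A. A \<subseteq> posnat \<and> (\<lambda>n. 1 / real n) summable_on A}"

text \<open>
  Increasing enumeration of an infinite set with arguments \<open>1, 2, \<dots>\<close>;
  the library function \<^const>\<open>enumerate\<close> starts at 0.
\<close>

definition enum_from_1 :: "nat set \<Rightarrow> nat \<Rightarrow> nat" where
  "enum_from_1 D i = enumerate D (i - 1)"

definition ideal_null :: "nat set set \<Rightarrow> (nat \<Rightarrow> real) \<Rightarrow> bool" where
  "ideal_null I x \<longleftrightarrow> (\<forall>\<epsilon>>0. {n \<in> posnat. \<bar>x n\<bar> \<ge> \<epsilon>} \<in> I)"

text \<open>
  Members of the dual filter of an ideal are infinite, so that the enumeration below
  lists the subsequence indexed by \<open>F\<close>.
\<close>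

definition dual_ideal_null :: "nat set set \<Rightarrow> (nat \<Rightarrow> real) \<Rightarrow> bool" where
  "dual_ideal_null I x \<longleftrightarrow>
     (\<exists>F\<in>dual_filter I. (\<lambda>k. x (enumerate F k)) \<longlonglongrightarrow> 0)"

text \<open>
  The sequence space \<open>\<ell>\<^sub>1\<close>, indexed by the positive integers: the entry at the
  superfluous index 0 is fixed to 0.
\<close>

typedef ell1 = "{a :: nat \<Rightarrow> real. a 0 = 0 \<and> summable (\<lambda>n. \<bar>a n\<bar>)}"
  morphisms ell1_nth Abs_ell1
  by (rule exI[of _ "\<lambda>_. 0"]) auto

setup_lifting type_definition_ell1

instantiation ell1 :: real_vector
begin

lift_definition zero_ell1 :: ell1 is "\<lambda>_. 0"
  by simp

lift_definition plus_ell1 :: "ell1 \<Rightarrow> ell1 \<Rightarrow> ell1" is "\<lambda>a b n. a n + b n"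
proof -
  fix a b :: "nat \<Rightarrow> real"
  assume a: "a 0 = 0 \<and> summable (\<lambda>n. \<bar>a n\<bar>)" and b: "b 0 = 0 \<and> summable (\<lambda>n. \<bar>b n\<bar>)"
  have "summable (\<lambda>n. \<bar>a n\<bar> + \<bar>b n\<bar>)"
    using a b by (intro summable_add) auto
  then have "summable (\<lambda>n. \<bar>a n + b n\<bar>)"
    by (rule summable_comparison_test') (auto intro: abs_triangle_ineq)
  then show "a 0 + b 0 = 0 \<and> summable (\<lambda>n. \<bar>a n + b n\<bar>)"
    using a b by simp
qed

lift_definition uminus_ell1 :: "ell1 \<Rightarrow> ell1" is "\<lambda>a n. - a n"
  by simp

definition minus_ell1 :: "ell1 \<Rightarrow> ell1 \<Rightarrow> ell1" where
  "minus_ell1 a b = a + (- b)"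

lift_definition scaleR_ell1 :: "real \<Rightarrow> ell1 \<Rightarrow> ell1" is "\<lambda>c a n. c * a n"
  by (auto simp: abs_mult intro: summable_mult)

instance
  by standard ((simp only: minus_ell1_def)?; (transfer; simp add: algebra_simps fun_eq_iff)?)+

end

instantiation ell1 :: real_normed_vector
begin

lift_definition norm_ell1 :: "ell1 \<Rightarrow> real" is "\<lambda>a. \<Sum>n. \<bar>a (Suc n)\<bar>" .

definition dist_ell1 :: "ell1 \<Rightarrow> ell1 \<Rightarrow> real" where
  "dist_ell1 a b = norm (a - b)"

definition sgn_ell1 :: "ell1 \<Rightarrow> ell1" where
  "sgn_ell1 a = inverse (norm a) *\<^sub>R a"

definition uniformity_ell1 :: "(ell1 \<times> ell1) filter" where
  "uniformity_ell1 = (INF e\<in>{0<..}. principal {(x, y). dist x y < e})"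

definition open_ell1 :: "ell1 set \<Rightarrow> bool" where
  "open_ell1 U \<longleftrightarrow> (\<forall>x\<in>U. \<forall>\<^sub>F (x', y) in uniformity. x' = x \<longrightarrow> y \<in> U)"

instance
proof
  fix a b :: ell1 and c :: real
  show "dist a b = norm (a - b)"
    by (rule dist_ell1_def)
  show "sgn a = inverse (norm a) *\<^sub>R a"
    by (rule sgn_ell1_def)
  show "uniformity = (INF e\<in>{0<..}. principal {(x :: ell1, y). dist x y < e})"
    by (rule uniformity_ell1_def)
  show "open U \<longleftrightarrow> (\<forall>x\<in>U. \<forall>\<^sub>F (x', y) in uniformity. x' = x \<longrightarrow> y \<in> U)" for U :: "ell1 set"
    by (rule open_ell1_def)
  show "norm a = 0 \<longleftrightarrow> a = 0"
  proof transfer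
    fix a :: "nat \<Rightarrow> real"
    assume a: "a 0 = 0 \<and> summable (\<lambda>n. \<bar>a n\<bar>)"
    then have s: "summable (\<lambda>n. \<bar>a (Suc n)\<bar>)"
      by (subst summable_Suc_iff) auto
    have "(\<forall>n. a (Suc n) = 0) \<longleftrightarrow> a = (\<lambda>_. 0)"
      using a by (auto simp: fun_eq_iff) (metis not0_implies_Suc)
    then show "(\<Sum>n. \<bar>a (Suc n)\<bar>) = 0 \<longleftrightarrow> a = (\<lambda>_. 0)"
      using suminf_eq_zero_iff[OF s] by simp
  qed
  show "norm (a + b) \<le> norm a + norm b"
  proof transfer
    fix a b :: "nat \<Rightarrow> real"
    assume "a 0 = 0 \<and> summable (\<lambda>n. \<bar>a n\<bar>)" and "b 0 = 0 \<and> summable (\<lambda>n. \<bar>b n\<bar>)"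
    then have s: "summable (\<lambda>n. \<bar>a (Suc n)\<bar>)" "summable (\<lambda>n. \<bar>b (Suc n)\<bar>)"
      by (subst summable_Suc_iff; auto)+
    then have ab: "summable (\<lambda>n. \<bar>a (Suc n)\<bar> + \<bar>b (Suc n)\<bar>)"
      by (rule summable_add)
    then have "summable (\<lambda>n. \<bar>a (Suc n) + b (Suc n)\<bar>)"
      by (rule summable_comparison_test') (auto intro: abs_triangle_ineq)
    then have "(\<Sum>n. \<bar>a (Suc n) + b (Suc n)\<bar>) \<le> (\<Sum>n. \<bar>a (Suc n)\<bar> + \<bar>b (Suc n)\<bar>)"
      by (intro suminf_le ab) (auto intro: abs_triangle_ineq)
    then show "(\<Sum>n. \<bar>a (Suc n) + b (Suc n)\<bar>) \<le> (\<Sum>n. \<bar>a (Suc n)\<bar>) + (\<Sum>n. \<bar>b (Suc n)\<bar>)"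
      using suminf_add[OF s] by simp
  qed
  show "norm (c *\<^sub>R a) = \<bar>c\<bar> * norm a"
  proof transfer
    fix c :: real and a :: "nat \<Rightarrow> real"
    assume "a 0 = 0 \<and> summable (\<lambda>n. \<bar>a n\<bar>)"
    then have "summable (\<lambda>n. \<bar>a (Suc n)\<bar>)"
      by (subst summable_Suc_iff) auto
    then show "(\<Sum>n. \<bar>c * a (Suc n)\<bar>) = \<bar>c\<bar> * (\<Sum>n. \<bar>a (Suc n)\<bar>)"
      by (simp add: abs_mult suminf_mult)
  qed
qed

end

definition AOS :: "nat set set \<Rightarrow> ell1 set" where
  "AOS I = {a. \<not> ideal_null I (\<lambda>n. real n * ell1_nth a n)}"

text \<open>
  \<open>AOS_dual I\<close> is \<open>AOS(I\<^sup>*)\<close>; it is a function of the ideal \<open>I\<close> itself.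
\<close>

definition AOS_dual :: "nat set set \<Rightarrow> ell1 set" where
  "AOS_dual I = {a. \<not> dual_ideal_null I (\<lambda>n. real n * ell1_nth a n)}"

text \<open>
  The cardinal is given by a set \<open>K\<close> of that cardinality, and the dimension of \<open>V\<close> is the
  cardinality of a Hamel basis.
\<close>

definition lineable :: "'k set \<Rightarrow> 'a::real_vector set \<Rightarrow> bool" where
  "lineable K Y \<longleftrightarrow>
     (\<exists>V. subspace V \<and> V \<subseteq> Y \<union> {0} \<and> (\<exists>B. independent B \<and> span B = V \<and> B \<approx> K))"

definition infinite_dimensional :: "'a::real_vector set \<Rightarrow> bool" where
  "infinite_dimensional V \<longleftrightarrow> \<not> (\<exists>B. finite B \<and> span B = V)"

definition spaceable :: "'a::real_normed_vector set \<Rightarrow> bool" where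
  "spaceable Y \<longleftrightarrow>
     (\<exists>V. subspace V \<and> closed V \<and> infinite_dimensional V \<and> V \<subseteq> Y \<union> {0})"

end

theory Submission
  imports Defs
begin

text \<open>
  The images of \<open>C\<close> under the enumerations \<open>e\<close> of the \<open>D\<^sub>n\<close> are pairwise disjoint coideal sets
  \<open>E\<^sub>n\<close>, and \<open>e(i) \<ge> i\<close> bounds all the sums \<open>\<Sum>m\<in>E\<^sub>n. 1/m\<close> by the one over \<open>C\<close>. The sequences \<open>a\<close>
  vanishing off \<open>\<Union>n. E\<^sub>n\<close> for which \<open>m a\<^sub>m\<close> is constant on every \<open>E\<^sub>n\<close> form a closed subspace of
  \<open>\<ell>\<^sub>1\<close>, and a nonzero member has \<open>\<bar>m a\<^sub>m\<bar>\<close> bounded away from 0 on some \<open>E\<^sub>n\<close>. Every absolutely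
  summable sequence of constants occurs; the geometric sequences \<open>r\<^sup>n\<close>, \<open>0 < r < 1\<close>, give a
  linearly independent family of size continuum.
\<close>

section \<open>Coideal sets and their increasing enumerations\<close>

lemma coideal_subset_posnat: "A \<in> coideal I \<Longrightarrow> A \<subseteq> posnat"
  by (simp add: coideal_def)

lemma coideal_infinite:
  assumes "ideal_on_posnat I" "A \<in> coideal I"
  shows "infinite A"
  using assms unfolding coideal_def ideal_on_posnat_def by auto

lemma Suc_le_enumerate:
  fixes D :: "nat set"
  assumes "infinite D" "D \<subseteq> {1..}"
  shows "Suc n \<le> enumerate D n"
proof (induction n)
  case 0
  then show ?case
    using enumerate_in_set[OF assms(1), of 0] assms(2) by auto
next
  case (Suc n)
  then show ?case
    using enumerate_step[OF assms(1), of n] by linarith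
qed

text \<open>The bound on the right does not depend on \<open>D\<close>, so a single constant will
  serve all blocks at once.\<close>

lemma sum_reciprocals_enumerate_le:
  assumes D: "infinite D" "D \<subseteq> posnat"
    and C: "C \<in> summable_ideal"
    and F: "finite F" "F \<subseteq> enum_from_1 D ` C"
  shows "(\<Sum>m\<in>F. 1 / real m) \<le> (\<Sum>\<^sub>\<infinity>i\<in>C. 1 / real i)"
proof -
  obtain G where G: "G \<subseteq> C" "finite G" "F = enum_from_1 D ` G"
    using finite_subset_image[OF F] by blast
  \<comment> \<open>Passing to the image can only merge nonnegative terms, so an inequality comes
    for free.\<close>
  have "(\<Sum>m\<in>F. 1 / real m) \<le> (\<Sum>i\<in>G. 1 / real (enum_from_1 D i))"
    unfolding G(3) using sum_image_le[OF G(2), of "\<lambda>m. 1 / real m" "enum_from_1 D"] by (simp add: o_def)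
  also have "\<dots> \<le> (\<Sum>i\<in>G. 1 / real i)"
  proof (rule sum_mono)
    fix i assume "i \<in> G"
    then have "1 \<le> i"
      using G(1) C unfolding summable_ideal_def by auto
    \<comment> \<open>The shift by one in \<open>enum_from_1\<close> cancels the \<open>Suc\<close>
      of the zero-based bound, because \<open>i\<close> is at least 1.\<close>
    moreover have "i \<le> enum_from_1 D i"
      using Suc_le_enumerate[OF D, of "i - 1"] \<open>1 \<le> i\<close> unfolding enum_from_1_def by simp
    ultimately show "1 / real (enum_from_1 D i) \<le> 1 / real i"
      by (intro divide_left_mono) auto
  qed
  also have "\<dots> \<le> (\<Sum>\<^sub>\<infinity>i\<in>C. 1 / real i)"
    using C G unfolding summable_ideal_def by (intro finite_sum_le_infsum) auto
  finally show ?thesis .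
qed

section \<open>Convergence along the ideal and along its dual filter\<close>

text \<open>Large terms occur only on the discarded set \<open>A\<close> or among finitely many
  initial terms of the subsequence, and both sets are in the ideal.\<close>

lemma dual_ideal_null_imp_ideal_null:
  assumes I: "ideal_on_posnat I" and x: "dual_ideal_null I x"
  shows "ideal_null I x"
  unfolding ideal_null_def
proof (intro allI impI)
  fix \<epsilon> :: real
  assume "\<epsilon> > 0"
  obtain A where A: "A \<in> I" and lim: "(\<lambda>k. x (enumerate (posnat - A) k)) \<longlonglongrightarrow> 0"
    using x unfolding dual_ideal_null_def dual_filter_def by blast
  have un: "A \<union> B \<in> I" if "finite B" "B \<subseteq> posnat" for B
    using I A that unfolding ideal_on_posnat_def by blast
  have down: "B \<in> I" if "B \<subseteq> A'" "A' \<in> I" for A' B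
    using I that unfolding ideal_on_posnat_def by blast
  \<comment> \<open>Only for an infinite set does \<open>enumerate\<close> list exactly its
    elements.\<close>
  have inf: "infinite (posnat - A)"
  proof
    assume "finite (posnat - A)"
    from down[OF _ un[OF this]] have "posnat \<in> I" by blast
    then show False
      using I unfolding ideal_on_posnat_def by blast
  qed
  obtain N where N: "\<And>k. k \<ge> N \<Longrightarrow> \<bar>x (enumerate (posnat - A) k)\<bar> < \<epsilon>"
    using LIMSEQ_D[OF lim \<open>\<epsilon> > 0\<close>] by auto
  let ?B = "enumerate (posnat - A) ` {..<N}"
  have sub: "{n \<in> posnat. \<bar>x n\<bar> \<ge> \<epsilon>} \<subseteq> A \<union> ?B"
  proof
    fix n assume n: "n \<in> {n \<in> posnat. \<bar>x n\<bar> \<ge> \<epsilon>}"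
    show "n \<in> A \<union> ?B"
    proof (cases "n \<in> A")
      case False
      then obtain k where k: "n = enumerate (posnat - A) k"
        using n enumerate_Ex[OF inf, of n] by (metis (lifting) DiffI mem_Collect_eq)
      then have "k < N"
        using N[of k] n by (auto simp: not_le[symmetric])
      then show ?thesis
        using k by blast
    qed simp
  qed
  have "?B \<subseteq> posnat"
    using enumerate_in_set[OF inf] by blast
  then show "{n \<in> posnat. \<bar>x n\<bar> \<ge> \<epsilon>} \<in> I"
    by (intro down[OF sub] un) simp_all
qed

text \<open>Through this inclusion all claims about \<open>AOS_dual\<close> are inherited from
  \<open>AOS\<close>.\<close>

lemma AOS_subset_AOS_dual:
  assumes "ideal_on_posnat I"
  shows "AOS I \<subseteq> AOS_dual I"
  using dual_ideal_null_imp_ideal_null[OF assms] unfolding AOS_def AOS_dual_def by blast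

section \<open>Coordinate functionals\<close>

lemma ell1_nth_simps [simp]:
  "ell1_nth 0 n = 0"
  "ell1_nth (a + b) n = ell1_nth a n + ell1_nth b n"
  "ell1_nth (c *\<^sub>R a) n = c * ell1_nth a n"
  by (transfer; simp)+

lemma ell1_nth_sum [simp]: "ell1_nth (\<Sum>i\<in>A. f i) n = (\<Sum>i\<in>A. ell1_nth (f i) n)"
  by (induction A rule: infinite_finite_induct) auto

lemma abs_ell1_nth_le_norm: "\<bar>ell1_nth a n\<bar> \<le> norm a"
proof transfer
  fix a :: "nat \<Rightarrow> real" and n
  assume a: "a 0 = 0 \<and> summable (\<lambda>n. \<bar>a n\<bar>)"
  then have s: "summable (\<lambda>n. \<bar>a (Suc n)\<bar>)"
    by (subst summable_Suc_iff) auto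
  show "\<bar>a n\<bar> \<le> (\<Sum>n. \<bar>a (Suc n)\<bar>)"
  \<comment> \<open>The norm sums from index 1 on, so index 0 is settled by
    \<open>a 0 = 0\<close>.\<close>
  proof (cases n)
    case 0
    then show ?thesis
      using a by (simp add: suminf_nonneg[OF s])
  next
    case (Suc k)
    then show ?thesis
      using sum_le_suminf[OF s, of "{k}"] by simp
  qed
qed

lemma bounded_linear_ell1_nth: "bounded_linear (\<lambda>a. ell1_nth a n)"
  by (rule bounded_linear_intro[where K = 1]) (use abs_ell1_nth_le_norm in auto)

section \<open>The closed subspace attached to a family of blocks\<close>

text \<open>Constancy is expressed by pairwise equations instead of an existential constant: the
  space is then visibly an intersection of kernels of continuous functionals, hence closed.\<close>

definition block_space :: "(nat \<Rightarrow> nat set) \<Rightarrow> ell1 set" where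
  "block_space E =
     {a. (\<forall>m. m \<notin> \<Union>(range E) \<longrightarrow> ell1_nth a m = 0) \<and>
         (\<forall>n. \<forall>m\<in>E n. \<forall>k\<in>E n. real m * ell1_nth a m = real k * ell1_nth a k)}"

lemma block_spaceI:
  assumes "\<And>m. m \<notin> \<Union>(range E) \<Longrightarrow> ell1_nth a m = 0"
    and "\<And>n m k. m \<in> E n \<Longrightarrow> k \<in> E n \<Longrightarrow> real m * ell1_nth a m = real k * ell1_nth a k"
  shows "a \<in> block_space E"
  using assms unfolding block_space_def by blast

lemma block_spaceD:
  assumes "a \<in> block_space E"
  shows block_space_outside: "m \<notin> \<Union>(range E) \<Longrightarrow> ell1_nth a m = 0"
    and block_space_constant:
      "m \<in> E n \<Longrightarrow> k \<in> E n \<Longrightarrow> real m * ell1_nth a m = real k * ell1_nth a k"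
  using assms unfolding block_space_def by blast+

lemma subspace_block_space: "subspace (block_space E)"
proof (rule subspaceI)
  show "0 \<in> block_space E"
    by (rule block_spaceI) simp_all
next
  fix a b
  assume a: "a \<in> block_space E" and b: "b \<in> block_space E"
  show "a + b \<in> block_space E"
  proof (rule block_spaceI)
    fix n m k
    assume "m \<in> E n" "k \<in> E n"
    from block_space_constant[OF a this] block_space_constant[OF b this]
    show "real m * ell1_nth (a + b) m = real k * ell1_nth (a + b) k"
      by (simp add: distrib_left)
  qed (simp add: block_space_outside[OF a] block_space_outside[OF b])
next
  fix c :: real and a
  assume a: "a \<in> block_space E"
  show "c *\<^sub>R a \<in> block_space E"
  proof (rule block_spaceI)
    fix n m k
    assume "m \<in> E n" "k \<in> E n"
    from block_space_constant[OF a this]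
    show "real m * ell1_nth (c *\<^sub>R a) m = real k * ell1_nth (c *\<^sub>R a) k"
      by (simp add: mult.left_commute[of _ c])
  qed (simp add: block_space_outside[OF a])
qed

lemma closed_block_space: "closed (block_space E)"
  unfolding block_space_def Ball_def
  by (intro closed_Collect_conj closed_Collect_all closed_Collect_imp
        closed_Collect_eq open_Collect_const continuous_intros
        bounded_linear.continuous_on[OF bounded_linear_ell1_nth])

lemma block_space_subset_AOS:
  assumes I: "ideal_on_posnat I" and E: "\<And>n. E n \<in> coideal I"
  shows "block_space E \<subseteq> AOS I \<union> {0}"
proof
  fix a assume a: "a \<in> block_space E"
  show "a \<in> AOS I \<union> {0}"
  proof (cases "a = 0")
    case False
    then obtain m where m: "ell1_nth a m \<noteq> 0"
      using ell1_nth_inject[of a 0] by (auto simp: fun_eq_iff)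
    then obtain n where n: "m \<in> E n"
      using block_space_outside[OF a] by blast
    have Epos: "E n \<subseteq> posnat"
      by (rule coideal_subset_posnat[OF E])
    define c where "c = \<bar>real m * ell1_nth a m\<bar>"
    have "c > 0"
      using m n Epos unfolding c_def by auto
    have "E n \<subseteq> {k \<in> posnat. c \<le> \<bar>real k * ell1_nth a k\<bar>}"
    proof
      fix k assume k: "k \<in> E n"
      then have "real k * ell1_nth a k = real m * ell1_nth a m"
        using block_space_constant[OF a _ n] by blast
      then show "k \<in> {k \<in> posnat. c \<le> \<bar>real k * ell1_nth a k\<bar>}"
        using k Epos unfolding c_def by auto
    qed
    then have "{k \<in> posnat. c \<le> \<bar>real k * ell1_nth a k\<bar>} \<notin> I"
      using I E[of n] unfolding ideal_on_posnat_def coideal_def by blast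
    then show ?thesis
      using \<open>c > 0\<close> unfolding AOS_def ideal_null_def by blast
  qed simp
qed

text \<open>Put \<open>t n / m\<close> at each \<open>m\<close> in \<open>E n\<close>. Block
  \<open>n\<close> then contributes at most \<open>\<bar>t n\<bar> * S\<close> to the norm, and
  these bounds are summable.\<close>

lemma block_space_prescribed:
  fixes t :: "nat \<Rightarrow> real"
  assumes Epos: "\<And>n. E n \<subseteq> posnat" and disj: "disjoint_family E"
    and S: "\<And>n F. finite F \<Longrightarrow> F \<subseteq> E n \<Longrightarrow> (\<Sum>m\<in>F. 1 / real m) \<le> S"
    and t: "summable (\<lambda>n. \<bar>t n\<bar>)"
  shows "\<exists>a\<in>block_space E. \<forall>n. \<forall>m\<in>E n. real m * ell1_nth a m = t n"
proof -
  define U where "U = \<Union>(range E)"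
  \<comment> \<open>By disjointness the least index is the only one; off \<open>U\<close> the value
    of \<open>k\<close> never enters \<open>a\<close>.\<close>
  define k where "k m = (LEAST n. m \<in> E n)" for m
  define a where "a m = (if m \<in> U then t (k m) / real m else 0)" for m
  have kE: "m \<in> E (k m)" if "m \<in> U" for m
    using that LeastI_ex[of "\<lambda>n. m \<in> E n"] unfolding U_def k_def by blast
  have k_eq: "k m = n" if "m \<in> E n" for m n
    using that kE[of m] disj unfolding disjoint_family_on_def U_def by blast
  have "S \<ge> 0"
    using S[of "{}"] by simp
  have "summable (\<lambda>m. \<bar>a m\<bar>)"
  proof (rule summableI_nonneg_bounded)
    fix N
    let ?F = "{..<N} \<inter> U"
    have "(\<Sum>m<N. \<bar>a m\<bar>) = (\<Sum>m\<in>?F. \<bar>t (k m)\<bar> / real m)"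
      by (intro sum.mono_neutral_cong_right) (auto simp: a_def)
    \<comment> \<open>Terms are grouped by block; each group runs over a finite subset of one
      \<open>E n\<close>, where \<open>S\<close> applies.\<close>
    also have "\<dots> = (\<Sum>n\<in>k ` ?F. \<Sum>m | m \<in> ?F \<and> k m = n. \<bar>t (k m)\<bar> / real m)"
      by (rule sum.image_gen) simp
    also have "\<dots> = (\<Sum>n\<in>k ` ?F. \<bar>t n\<bar> * (\<Sum>m | m \<in> ?F \<and> k m = n. 1 / real m))"
      by (simp add: sum_distrib_left)
    also have "\<dots> \<le> (\<Sum>n\<in>k ` ?F. \<bar>t n\<bar> * S)"
    proof (intro sum_mono mult_left_mono)
      fix n
      show "(\<Sum>m | m \<in> ?F \<and> k m = n. 1 / real m) \<le> S"
        by (rule S[of _ n]) (use kE in auto)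
    qed simp
    also have "\<dots> = (\<Sum>n\<in>k ` ?F. \<bar>t n\<bar>) * S"
      by (simp add: sum_distrib_right)
    also have "\<dots> \<le> (\<Sum>n. \<bar>t n\<bar>) * S"
      by (intro mult_right_mono sum_le_suminf t \<open>S \<ge> 0\<close>) auto
    finally show "(\<Sum>m<N. \<bar>a m\<bar>) \<le> (\<Sum>n. \<bar>t n\<bar>) * S" .
  qed simp
  moreover have "a 0 = 0"
    by (simp add: a_def)
  ultimately have nth: "ell1_nth (Abs_ell1 a) = a"
    by (simp add: Abs_ell1_inverse)
  have val: "real m * a m = t n" if "m \<in> E n" for m n
    using that Epos[of n] k_eq[OF that] by (auto simp: a_def U_def)
  have "a m = 0" if "m \<notin> \<Union>(range E)" for m
    using that by (simp add: a_def U_def)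
  with val have "Abs_ell1 a \<in> block_space E"
    by (simp add: block_space_def nth)
  with val show ?thesis
    by (intro bexI[of _ "Abs_ell1 a"]) (auto simp: nth)
qed

section \<open>A linearly independent family of size continuum\<close>

text \<open>A relation against all powers is one against all polynomials; the polynomial
  \<open>p\<close> vanishing on \<open>J - {s}\<close> but not at \<open>s\<close> isolates
  \<open>c s\<close>.\<close>

lemma geometric_sequences_independent:
  fixes c :: "real \<Rightarrow> real"
  assumes J: "finite J" and eq: "\<And>n. (\<Sum>r\<in>J. c r * r ^ n) = 0" and s: "s \<in> J"
  shows "c s = 0"
proof -
  define p where "p = (\<Prod>r\<in>J - {s}. [:- r, 1:])"
  have poly_p: "poly p x = (\<Prod>r\<in>J - {s}. x - r)" for x
    unfolding p_def poly_prod by simp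
  have "(\<Sum>r\<in>J. c r * poly p r) = (\<Sum>r\<in>J. \<Sum>i\<le>degree p. coeff p i * (c r * r ^ i))"
    by (simp add: poly_altdef sum_distrib_left mult.left_commute)
  also have "\<dots> = (\<Sum>i\<le>degree p. coeff p i * (\<Sum>r\<in>J. c r * r ^ i))"
    unfolding sum_distrib_left by (rule sum.swap)
  also have "\<dots> = 0"
    by (simp add: eq)
  also have "(\<Sum>r\<in>J. c r * poly p r) = c s * poly p s + (\<Sum>r\<in>J - {s}. c r * poly p r)"
    using J s by (simp add: sum.remove)
  also have "(\<Sum>r\<in>J - {s}. c r * poly p r) = 0"
    using J by (intro sum.neutral) (auto simp: poly_p intro!: prod_zero)
  finally show ?thesis
    using J by (simp add: poly_p)
qed

lemma block_space_independent_continuum: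
  assumes Epos: "\<And>n. E n \<subseteq> posnat" and disj: "disjoint_family E" and ne: "\<And>n. E n \<noteq> {}"
    and S: "\<And>n F. finite F \<Longrightarrow> F \<subseteq> E n \<Longrightarrow> (\<Sum>m\<in>F. 1 / real m) \<le> S"
  shows "\<exists>B\<subseteq>block_space E. independent B \<and> B \<approx> (UNIV :: real set)"
proof -
  \<comment> \<open>These ratios make the geometric series converge, and the interval still has the
    size of the reals.\<close>
  let ?R = "{0<..<1::real}"
  have "\<forall>r\<in>?R. \<exists>a\<in>block_space E. \<forall>n. \<forall>m\<in>E n. real m * ell1_nth a m = r ^ n"
    by (intro ballI block_space_prescribed[OF Epos disj S]) (auto simp: power_abs[symmetric])
  then obtain f where f: "\<And>r. r \<in> ?R \<Longrightarrow> f r \<in> block_space E"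
    and val: "\<And>r n m. r \<in> ?R \<Longrightarrow> m \<in> E n \<Longrightarrow> real m * ell1_nth (f r) m = r ^ n"
    by metis
  \<comment> \<open>One point per block suffices: evaluation at \<open>q n\<close> turns a relation
    among the \<open>f r\<close> into one among the \<open>r ^ n\<close>.\<close>
  define q where "q n = (SOME m. m \<in> E n)" for n
  have q: "q n \<in> E n" for n
    by (simp add: q_def some_in_eq ne)
  have inj: "inj_on f ?R"
  proof (rule inj_onI)
    fix r s
    assume r: "r \<in> ?R" and s: "s \<in> ?R" and "f r = f s"
    \<comment> \<open>Block 1 is read off, since block 0 carries \<open>r ^ 0 = 1\<close> for every
      ratio.\<close>
    then have "r ^ 1 = s ^ 1"
      by (simp only: val[OF r q, symmetric] val[OF s q, symmetric])
    then show "r = s"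
      by simp
  qed
  have "independent (f ` ?R)"
    unfolding independent_explicit_module
  proof (intro allI impI)
    fix T u v
    assume "finite T" "T \<subseteq> f ` ?R" and sum0: "(\<Sum>w\<in>T. u w *\<^sub>R w) = 0" and "v \<in> T"
    then obtain J where J: "J \<subseteq> ?R" "finite J" "T = f ` J"
      using finite_subset_image[OF \<open>finite T\<close> \<open>T \<subseteq> f ` ?R\<close>] by blast
    have zero: "(\<Sum>r\<in>J. u (f r) *\<^sub>R f r) = 0"
      using sum0 inj_on_subset[OF inj J(1)] unfolding J(3) by (simp add: sum.reindex o_def)
    have "(\<Sum>r\<in>J. u (f r) * r ^ n) = 0" for n
    proof -
      have "(\<Sum>r\<in>J. u (f r) * r ^ n) = (\<Sum>r\<in>J. u (f r) * (real (q n) * ell1_nth (f r) (q n)))"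
        using J(1) val[OF _ q] by (intro sum.cong) auto
      also have "\<dots> = real (q n) * ell1_nth (\<Sum>r\<in>J. u (f r) *\<^sub>R f r) (q n)"
        by (simp add: sum_distrib_left mult.left_commute)
      finally show ?thesis
        by (simp add: zero)
    qed
    then show "u v = 0"
      using geometric_sequences_independent[OF J(2), of "\<lambda>r. u (f r)"] \<open>v \<in> T\<close> J(3) by auto
  qed
  moreover have "f ` ?R \<approx> ?R"
    using inj by (simp add: inj_on_image_eqpoll_self)
  then have "f ` ?R \<approx> (UNIV :: real set)"
    by (rule eqpoll_trans) (simp add: open_interval_eqpoll_reals)
  moreover have "f ` ?R \<subseteq> block_space E"
    using f by (rule image_subsetI)
  ultimately show ?thesis
    by blast
qed

section \<open>Lineability and spaceability\<close>

lemma infinite_dimensional_if_independent_subset: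
  assumes "B \<subseteq> V" "independent B" "infinite B"
  shows "infinite_dimensional V"
  unfolding infinite_dimensional_def
  using assms independent_span_bound by metis

text \<open>The witness is \<open>span B\<close>, whose dimension is known exactly; \<open>B\<close>
  need not span \<open>V\<close>.\<close>

lemma lineable_if_independent_subset:
  assumes "subspace V" "V \<subseteq> Y \<union> {0}" "B \<subseteq> V" "independent B" "B \<approx> K"
  shows "lineable K Y"
  unfolding lineable_def
proof (intro exI conjI)
  show "span B \<subseteq> Y \<union> {0}"
    using span_minimal[OF assms(3,1)] assms(2) by (rule subset_trans)
qed (use assms in auto)

text \<open>Stated for an arbitrary superset \<open>Y\<close>, so that \<open>AOS I\<close> and
  \<open>AOS_dual I\<close> are both instances.\<close>

lemma AOS_superset_large:
  fixes E :: "nat \<Rightarrow> nat set"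
  assumes I: "ideal_on_posnat I" and E: "\<And>n. E n \<in> coideal I" and disj: "disjoint_family E"
    and S: "\<And>n F. finite F \<Longrightarrow> F \<subseteq> E n \<Longrightarrow> (\<Sum>m\<in>F. 1 / real m) \<le> S"
    and Y: "AOS I \<subseteq> Y"
  shows "Y \<noteq> {}" "lineable (UNIV :: real set) Y" "spaceable Y"
proof -
  have Epos: "E n \<subseteq> posnat" and Ene: "E n \<noteq> {}" for n
    using coideal_infinite[OF I E] coideal_subset_posnat[OF E] infinite_imp_nonempty by auto
  have "\<exists>B\<subseteq>block_space E. independent B \<and> B \<approx> (UNIV :: real set)"
    by (rule block_space_independent_continuum[OF Epos disj Ene S])
  then obtain B where B: "B \<subseteq> block_space E" "independent B" "B \<approx> (UNIV :: real set)"
    by auto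
  have V: "block_space E \<subseteq> Y \<union> {0}"
    using block_space_subset_AOS[where E = E, OF I E] Y by auto
  show "lineable (UNIV :: real set) Y"
    by (rule lineable_if_independent_subset[OF subspace_block_space V B])
  have "infinite B"
    using eqpoll_finite_iff[OF B(3)] infinite_UNIV_char_0 by auto
  then have "infinite_dimensional (block_space E)"
    by (rule infinite_dimensional_if_independent_subset[OF B(1,2)])
  then show "spaceable Y"
    unfolding spaceable_def using subspace_block_space closed_block_space V by auto
  have "\<not> B \<subseteq> {0}"
    using \<open>infinite B\<close> finite_subset by auto
  then show "Y \<noteq> {}"
    using B(1) V by auto
qed

theorem theorem4p6:
  fixes I :: "nat set set"
  assumes "ideal_on_posnat I"
    and "\<exists>(D :: nat \<Rightarrow> nat set) C.
           (\<forall>n\<in>posnat. D n \<in> coideal I) \<and>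
           disjoint_family_on D posnat \<and>
           C \<in> coideal I \<inter> summable_ideal \<and>
           (\<forall>n\<in>posnat. {enum_from_1 (D n) i | i. i \<in> C} \<in> coideal I)"
  shows "AOS I \<noteq> {} \<and>
         AOS_dual I \<noteq> {} \<and>
         lineable (UNIV :: real set) (AOS I) \<and>
         lineable (UNIV :: real set) (AOS_dual I) \<and>
         spaceable (AOS I) \<and>
         spaceable (AOS_dual I)"
proof -
  obtain D C where D: "\<And>n. n \<in> posnat \<Longrightarrow> D n \<in> coideal I"
    and disj: "disjoint_family_on D posnat" and C: "C \<in> summable_ideal"
    and DC: "\<And>n. n \<in> posnat \<Longrightarrow> enum_from_1 (D n) ` C \<in> coideal I"
    using assms(2) unfolding setcompr_eq_image by auto
  \<comment> \<open>The given sets are indexed from 1, the blocks from 0.\<close>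
  define E where "E n = enum_from_1 (D (Suc n)) ` C" for n
  have D': "D (Suc n) \<subseteq> posnat" "infinite (D (Suc n))" for n
    using coideal_subset_posnat[OF D, of "Suc n"] coideal_infinite[OF assms(1) D, of "Suc n"]
    by simp_all
  have E: "E n \<in> coideal I" for n
    unfolding E_def by (rule DC) simp
  \<comment> \<open>The blocks inherit disjointness from the sets \<open>D n\<close>.\<close>
  have ED: "E n \<subseteq> D (Suc n)" for n
    unfolding E_def enum_from_1_def by (rule image_subsetI) (rule enumerate_in_set[OF D'(2)])
  have "E m \<inter> E n = {}" if "m \<noteq> n" for m n
    using Int_mono[OF ED[of m] ED[of n]] disjoint_family_onD[OF disj, of "Suc m" "Suc n"] that by simp
  then have Edisj: "disjoint_family E"
    by (simp add: disjoint_family_on_def)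
  have Esum: "(\<Sum>m\<in>F. 1 / real m) \<le> (\<Sum>\<^sub>\<infinity>i\<in>C. 1 / real i)" if "finite F" "F \<subseteq> E n" for n F
    by (rule sum_reciprocals_enumerate_le[OF D'(2,1) C that[unfolded E_def]])
  have "Y \<noteq> {} \<and> lineable (UNIV :: real set) Y \<and> spaceable Y" if Y: "AOS I \<subseteq> Y" for Y
    by (intro conjI; rule AOS_superset_large[OF assms(1) E Edisj _ Y]; rule Esum)
  from this[OF order_refl] this[OF AOS_subset_AOS_dual[OF assms(1)]] show ?thesis
    by simp
qed

end
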